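(* Let $\mathbf A=(A,R,{}')$ be a directed relational system with involution and $|$ a Sheffer operation assigned to $\mathbf A$. Then $R$ is transitive if and only if for all $x,y,z\in A$, $$x\,\big|\,\Big(\big(((x|y)|(x|y))|z\big)\,\big|\,\big(((x|y)|(x|y))|z\big)\Big)=((x|y)|(x|y))|z.$$
   Context: For a binary relation $R$ on a non-empty set $A$ and $a,b\in A$, let $U(a,b):=\{x\in A\mid (a,x),(b,x)\in R\}$ and $L(a,b):=\{x\in A\mid (x,a),(x,b)\in R\}$. A directed relational system with involution is a triple $(A,R,{}')$ where $A$ is a non-empty set, $R$ is a reflexive binary relation on $A$, $U(x,y)\neq\emptyset$ and $L(x,y)\neq\emptyset$ for all $x,y\in A$, and $'$ is a unary operation on $A$ such that $x''=x$ for all $x\in A$ and $(x,y)\in R$ implies $(y',x')\in R$ for all $x,y\in A$. A Sheffer operation assigned to $\mathbf A=(A,R,{}')$ is a binary operation $|$ on $A$ such that for all $x,y\in A$: $x|y=y'$ if $(x',y')\in R$, and $x|y$ is an (arbitrary) element of $U(x',y')$ otherwise. (Every such operation satisfies $(x|y)|(x|x)=x$ and $(x|y)|(y|y)=y$ for all $x,y\in A$.) *)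

theory Defs
  imports Main
begin

definition upper_cone :: "'a set \<Rightarrow> 'a rel \<Rightarrow> 'a \<Rightarrow> 'a \<Rightarrow> 'a set" where
  "upper_cone A R a b = {x \<in> A. (a, x) \<in> R \<and> (b, x) \<in> R}"

definition lower_cone :: "'a set \<Rightarrow> 'a rel \<Rightarrow> 'a \<Rightarrow> 'a \<Rightarrow> 'a set" where
  "lower_cone A R a b = {x \<in> A. (x, a) \<in> R \<and> (x, b) \<in> R}"

(* refl_on does not entail that R is a relation on A, so this is required separately. *)
locale directed_relational_system_with_involution =
  fixes A :: "'a set" and R :: "'a rel" and invol :: "'a \<Rightarrow> 'a"
  assumes carrier_nonempty: "A \<noteq> {}"
    and rel_on_carrier: "R \<subseteq> A \<times> A"
    and rel_refl: "refl_on A R"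
    and upper_cone_nonempty: "\<And>x y. x \<in> A \<Longrightarrow> y \<in> A \<Longrightarrow> upper_cone A R x y \<noteq> {}"
    and lower_cone_nonempty: "\<And>x y. x \<in> A \<Longrightarrow> y \<in> A \<Longrightarrow> lower_cone A R x y \<noteq> {}"
    and invol_closed: "\<And>x. x \<in> A \<Longrightarrow> invol x \<in> A"
    and invol_invol: "\<And>x. x \<in> A \<Longrightarrow> invol (invol x) = x"
    and invol_antitone: "\<And>x y. x \<in> A \<Longrightarrow> y \<in> A \<Longrightarrow> (x, y) \<in> R \<Longrightarrow> (invol y, invol x) \<in> R"

definition sheffer_operation ::
  "'a set \<Rightarrow> 'a rel \<Rightarrow> ('a \<Rightarrow> 'a) \<Rightarrow> ('a \<Rightarrow> 'a \<Rightarrow> 'a) \<Rightarrow> bool" where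
  "sheffer_operation A R invol s \<longleftrightarrow>
    (\<forall>x\<in>A. \<forall>y\<in>A. s x y \<in> A \<and>
      (if (invol x, invol y) \<in> R then s x y = invol y
       else s x y \<in> upper_cone A R (invol x) (invol y)))"

end

theory Submission
  imports Defs
begin

text \<open>
  Write \<open>a \<le> b\<close> for \<open>(a, b) \<in> R\<close>, a reflexive but not necessarily transitive relation.
  The Sheffer operation encodes the whole structure: the involution is its diagonal,
  \<open>x \<parallel> x = x'\<close>, and the relation is recovered from
  \<open>x \<parallel> (u \<parallel> u) = u \<longleftrightarrow> x' \<le> u\<close> (lemma \<open>sheffer_absorb_iff\<close>). Taking
  \<open>u = (x \<parallel> y)' \<parallel> z\<close>, the identity of the theorem therefore says precisely that
  \<open>x' \<le> (x \<parallel> y)' \<parallel> z\<close> for all \<open>x, y, z\<close>.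

  Every Sheffer product dominates the complements of its factors
  (\<open>sheffer_upper_left\<close>), so there is always a chain
  \<open>x' \<le> x \<parallel> y \<le> (x \<parallel> y)' \<parallel> z\<close>, and transitivity of \<open>R\<close> gives the identity.
  Conversely, every chain \<open>a \<le> b \<le> c\<close> is of this form: for \<open>x = a'\<close>, \<open>y = b'\<close>,
  \<open>z = c'\<close> the products are not arbitrary upper bounds but evaluate to
  \<open>x \<parallel> y = b\<close> and \<open>b' \<parallel> c' = c\<close>, so the identity yields \<open>a \<le> c\<close>.
\<close>

context directed_relational_system_with_involution
begin

lemma rel_refl_point: "x \<in> A \<Longrightarrow> (x, x) \<in> R"
  using rel_refl by (simp add: refl_on_def)

lemma sheffer_closed:
  assumes "sheffer_operation A R invol s" "x \<in> A" "y \<in> A"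
  shows "s x y \<in> A"
  using assms by (simp add: sheffer_operation_def)

lemma sheffer_comparable:
  assumes "sheffer_operation A R invol s" "x \<in> A" "y \<in> A" "(invol x, invol y) \<in> R"
  shows "s x y = invol y"
  using assms by (simp add: sheffer_operation_def)

lemma sheffer_diagonal:
  assumes "sheffer_operation A R invol s" "x \<in> A"
  shows "s x x = invol x"
  using assms by (simp add: sheffer_comparable rel_refl_point invol_closed)

text \<open>
  In the comparable case the product is \<open>y'\<close>, which lies above \<open>x'\<close> by the very
  case condition; otherwise the product is chosen among the common upper bounds.
\<close>

lemma sheffer_upper_left:
  assumes "sheffer_operation A R invol s" "x \<in> A" "y \<in> A"
  shows "(invol x, s x y) \<in> R"
proof (cases "(invol x, invol y) \<in> R")
  case True
  then show ?thesis
    using assms by (simp add: sheffer_comparable)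
next
  case False
  then have "s x y \<in> upper_cone A R (invol x) (invol y)"
    using assms by (simp add: sheffer_operation_def)
  then show ?thesis
    by (simp add: upper_cone_def)
qed

text \<open>
  The equation on the left expresses the relation by the operation alone. If
  \<open>x' \<le> u\<close>, the product of \<open>x\<close> and \<open>u'\<close> is not a matter of choice: it is
  \<open>u'' = u\<close>. Conversely, any product with left factor \<open>x\<close> lies above \<open>x'\<close>,
  so \<open>u\<close> can equal such a product only if \<open>x' \<le> u\<close>.
\<close>

lemma sheffer_absorb_iff:
  assumes s: "sheffer_operation A R invol s" and "x \<in> A" "u \<in> A"
  shows "s x (s u u) = u \<longleftrightarrow> (invol x, u) \<in> R"
proof
  assume "s x (s u u) = u"
  then show "(invol x, u) \<in> R"
    using sheffer_upper_left[OF s, of x "s u u"] sheffer_closed[OF s] assms by auto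
next
  assume "(invol x, u) \<in> R"
  then show "s x (s u u) = u"
    using sheffer_comparable[OF s, of x "invol u"] assms
    by (simp add: sheffer_diagonal[OF s] invol_closed invol_invol)
qed

end

theorem theorem4p3:
  fixes A :: "'a set" and R :: "'a rel" and invol :: "'a \<Rightarrow> 'a"
    and s :: "'a \<Rightarrow> 'a \<Rightarrow> 'a"  (infixl "\<parallel>" 70)
  assumes "directed_relational_system_with_involution A R invol"
    and "sheffer_operation A R invol s"
  shows "trans R \<longleftrightarrow>
    (\<forall>x\<in>A. \<forall>y\<in>A. \<forall>z\<in>A.
      x \<parallel> ((((x \<parallel> y) \<parallel> (x \<parallel> y)) \<parallel> z) \<parallel> (((x \<parallel> y) \<parallel> (x \<parallel> y)) \<parallel> z))
        = ((x \<parallel> y) \<parallel> (x \<parallel> y)) \<parallel> z)"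
proof -
  interpret directed_relational_system_with_involution A R invol by (fact assms(1))
  note s = assms(2)
  have identity_iff: "x \<parallel> ((((x \<parallel> y) \<parallel> (x \<parallel> y)) \<parallel> z) \<parallel> (((x \<parallel> y) \<parallel> (x \<parallel> y)) \<parallel> z))
        = ((x \<parallel> y) \<parallel> (x \<parallel> y)) \<parallel> z \<longleftrightarrow> (invol x, invol (x \<parallel> y) \<parallel> z) \<in> R"
    if "x \<in> A" "y \<in> A" "z \<in> A" for x y z
    using that sheffer_absorb_iff[OF s, of x "((x \<parallel> y) \<parallel> (x \<parallel> y)) \<parallel> z"]
    by (simp add: sheffer_closed[OF s] sheffer_diagonal[OF s, of "x \<parallel> y"] invol_closed)
  have "trans R \<longleftrightarrow>
    (\<forall>x\<in>A. \<forall>y\<in>A. \<forall>z\<in>A. (invol x, invol (x \<parallel> y) \<parallel> z) \<in> R)"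
  proof
    assume "trans R"
    show "\<forall>x\<in>A. \<forall>y\<in>A. \<forall>z\<in>A. (invol x, invol (x \<parallel> y) \<parallel> z) \<in> R"
    proof (intro ballI)
      fix x y z assume xyz: "x \<in> A" "y \<in> A" "z \<in> A"
      have "(invol x, x \<parallel> y) \<in> R"
        using xyz by (simp add: sheffer_upper_left[OF s])
      moreover have "(x \<parallel> y, invol (x \<parallel> y) \<parallel> z) \<in> R"
        using xyz sheffer_upper_left[OF s, of "invol (x \<parallel> y)" z]
        by (simp add: sheffer_closed[OF s] invol_closed invol_invol)
      ultimately show "(invol x, invol (x \<parallel> y) \<parallel> z) \<in> R"
        using \<open>trans R\<close> by (blast dest: transD)
    qed
  next
    assume above: "\<forall>x\<in>A. \<forall>y\<in>A. \<forall>z\<in>A. (invol x, invol (x \<parallel> y) \<parallel> z) \<in> R"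
    show "trans R"
    proof (rule transI)
      fix a b c assume ab: "(a, b) \<in> R" and bc: "(b, c) \<in> R"
      then have abc: "a \<in> A" "b \<in> A" "c \<in> A"
        using rel_on_carrier by auto
      have "invol a \<parallel> invol b = b"
        using sheffer_comparable[OF s, of "invol a" "invol b"] ab abc
        by (simp add: invol_closed invol_invol)
      moreover have "invol b \<parallel> invol c = c"
        using sheffer_comparable[OF s, of "invol b" "invol c"] bc abc
        by (simp add: invol_closed invol_invol)
      moreover have "(a, invol (invol a \<parallel> invol b) \<parallel> invol c) \<in> R"
        using above abc invol_closed invol_invol by metis
      ultimately show "(a, c) \<in> R" by simp
    qed
  qed
  then show ?thesis by (simp add: identity_iff)
qed

end
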